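(* Let $L=0$. For any $k\in[0,1)$, no randomized strategyproof mechanism has an approximation ratio less than $\frac{6+6k}{5+7k}$ for the maximum cost.
   Context: Setting ($L=0$). Fix a constant $k\in[0,1)$. An instance consists of a point obstacle $o\in(0,1)$ and a profile $\mathbf x=(x_1,\ldots,x_n)$ of agent locations $x_i\in[0,o)\cup(o,1]$; $N=\{1,\ldots,n\}$, $N_1=\{i: x_i<o\}$, $N_2=\{i: x_i>o\}$. An edge is a pair $(a,b)$ with $a\in[0,o)$, $b\in(o,1]$. The cost of agent $i\in N_1$ is $cost(a,b,x_i)=|x_i-a|+k(b-a)+(1-b)$; the cost of agent $i\in N_2$ is $cost(a,b,x_i)=|x_i-b|+k(b-a)+a$. The maximum cost is $MC(a,b,\mathbf x)=\max_{i\in N}cost(a,b,x_i)$. The obstacle is publicly known; a randomized mechanism $f$ assigns, for every obstacle position $o$ and every number of agents, a probability distribution $P=f(\mathbf x)$ over edges to each location profile; the cost of agent $i$ is $cost(P,x_i)=\mathbb E_{(a,b)\sim P}[cost(a,b,x_i)]$, and the maximum cost of the mechanism is the expected maximum cost $\mathbb E_{(a,b)\sim P}[MC(a,b,\mathbf x)]$. It is strategyproof if for every agent $i$, every $\mathbf x$ and every $x_i'$ in the same region as $x_i$, $cost(f(x_i,\mathbf x_{-i}),x_i)\le cost(f(x_i',\mathbf x_{-i}),x_i)$. Its approximation ratio is the least $\alpha$ such that its expected maximum cost is at most $\alpha\cdot\min_{(a,b)}MC(a,b,\mathbf x)$ (minimum over all edges) for all instances, including all obstacle positions $o$. As a standing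 convention only anonymous mechanisms (outcome invariant under permutations of the agents) are considered. *)

theory Defs
  imports "HOL-Probability.Probability"
begin

definition edges :: "real \<Rightarrow> (real \<times> real) set" where
  "edges obs = {0..<obs} \<times> {obs<..1}"

text \<open>A profile is the list of the agents' locations, so its length is the number of agents.\<close>

definition profile :: "real \<Rightarrow> real list \<Rightarrow> bool" where
  "profile obs xs \<longleftrightarrow> xs \<noteq> [] \<and> set xs \<subseteq> {0..<obs} \<union> {obs<..1}"

definition cost :: "real \<Rightarrow> real \<Rightarrow> real \<times> real \<Rightarrow> real \<Rightarrow> real" where
  "cost k obs = (\<lambda>(a, b) x.
     if x < obs then \<bar>x - a\<bar> + k * (b - a) + (1 - b)
     else \<bar>x - b\<bar> + k * (b - a) + a)"

definition max_cost :: "real \<Rightarrow> real \<Rightarrow> real \<times> real \<Rightarrow> real list \<Rightarrow> real" where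
  "max_cost k obs e xs = Max (cost k obs e ` set xs)"

text \<open>The infimum below is a minimum, see \<open>opt_max_cost_attained\<close>.\<close>

definition opt_max_cost :: "real \<Rightarrow> real \<Rightarrow> real list \<Rightarrow> real" where
  "opt_max_cost k obs xs = (INF e\<in>edges obs. max_cost k obs e xs)"

lemma continuous_on_Max_image:
  fixes c :: "'a::topological_space \<Rightarrow> 'b \<Rightarrow> real"
  assumes "finite A" "A \<noteq> {}" "\<And>x. x \<in> A \<Longrightarrow> continuous_on S (\<lambda>e. c e x)"
  shows "continuous_on S (\<lambda>e. Max (c e ` A))"
  using assms
proof (induction A rule: finite_ne_induct)
  case (singleton x)
  then show ?case by simp
next
  case (insert x A)
  then show ?case by (simp add: continuous_on_max)
qed

lemma opt_max_cost_attained: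
  assumes k: "0 \<le> k" "k < 1" and obs: "0 < obs" "obs < 1" and xs: "profile obs xs"
  shows "\<exists>e\<in>edges obs. max_cost k obs e xs = opt_max_cost k obs xs \<and>
           (\<forall>e'\<in>edges obs. max_cost k obs e xs \<le> max_cost k obs e' xs)"
proof -
  define a0 where "a0 = Max (insert 0 {x \<in> set xs. x < obs})"
  define b0 where "b0 = Min (insert 1 {x \<in> set xs. \<not> x < obs})"
  have a0: "0 \<le> a0" "a0 < obs" and b0: "obs < b0" "b0 \<le> 1"
    using obs xs by (auto simp: a0_def b0_def profile_def)
  have xa: "x \<le> a0" if "x \<in> set xs" "x < obs" for x
    unfolding a0_def using that by (intro Max_ge) auto
  have xb: "b0 \<le> x" if "x \<in> set xs" "\<not> x < obs" for x
    unfolding b0_def using that by (intro Min_le) auto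
  define S where "S = {0..a0} \<times> {b0..1}"
  have ne: "set xs \<noteq> {}" using xs by (simp add: profile_def)
  have S: "S \<subseteq> edges obs" "S \<noteq> {}" "compact S"
    using a0 b0 by (auto simp: S_def edges_def intro!: compact_Times)
  have "continuous_on S (\<lambda>e. max_cost k obs e xs)"
    unfolding max_cost_def
  proof (intro continuous_on_Max_image ne finite_set)
    show "continuous_on S (\<lambda>e. cost k obs e x)" for x
      by (cases "x < obs") (auto simp: cost_def case_prod_unfold intro!: continuous_intros)
  qed
  from continuous_attains_inf[OF S(3,2) this] obtain e
    where e: "e \<in> S" "\<And>e'. e' \<in> S \<Longrightarrow> max_cost k obs e xs \<le> max_cost k obs e' xs"
    by blast
  have le: "max_cost k obs e xs \<le> max_cost k obs e' xs" if e': "e' \<in> edges obs" for e'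
  proof -
    obtain a b where ab: "e' = (a, b)" by (cases e')
    define e2 where "e2 = (min a a0, max b b0)"
    have "e2 \<in> S" using e' a0 b0 by (auto simp: ab e2_def S_def edges_def)
    then have "max_cost k obs e xs \<le> max_cost k obs e2 xs" by (rule e(2))
    also have "max_cost k obs e2 xs \<le> max_cost k obs e' xs"
    proof -
      define a' b' where "a' = min a a0" and "b' = max b b0"
      have e2: "e2 = (a', b')" by (simp add: e2_def a'_def b'_def)
      have ka: "k * (a - a') \<le> a - a'" and kb: "k * (b' - b) \<le> b' - b"
        using k by (auto simp: a'_def b'_def intro!: mult_left_le_one_le)
      have kd: "k * (b' - a') = k * (b - a) + k * (a - a') + k * (b' - b)"
        by (simp add: algebra_simps)
      have "cost k obs e2 x \<le> cost k obs e' x" if x: "x \<in> set xs" for x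
      proof (cases "x < obs")
        case True
        have "\<bar>x - a'\<bar> + (a - a') \<le> \<bar>x - a\<bar>"
          using xa[OF x True] by (simp add: a'_def min_def)
        then show ?thesis
          using True ka kb kd by (simp add: cost_def e2 ab)
      next
        case False
        have "\<bar>x - b'\<bar> + (b' - b) \<le> \<bar>x - b\<bar>"
          using xb[OF x False] by (simp add: b'_def max_def)
        then show ?thesis
          using False ka kb kd by (simp add: cost_def e2 ab)
      qed
      moreover have "cost k obs e' x \<le> max_cost k obs e' xs" if "x \<in> set xs" for x
        unfolding max_cost_def using that by (intro Max_ge) auto
      ultimately show ?thesis
        unfolding max_cost_def[of k obs e2] using ne order_trans
        by (intro Max.boundedI) blast+
    qed
    finally show ?thesis .
  qed
  have "opt_max_cost k obs xs = max_cost k obs e xs"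
    unfolding opt_max_cost_def
    by (rule cInf_eq_minimum) (use e(1) S(1) le in auto)
  with e(1) S(1) le show ?thesis by auto
qed

text \<open>
  The mechanism knows the obstacle, and its outcome is an arbitrary (not necessarily discrete)
  Borel probability measure on the set of edges.
\<close>

type_synonym mechanism = "real \<Rightarrow> real list \<Rightarrow> (real \<times> real) measure"

definition randomized_mechanism :: "mechanism \<Rightarrow> bool" where
  "randomized_mechanism f \<longleftrightarrow>
     (\<forall>obs\<in>{0<..<1}. \<forall>xs. profile obs xs \<longrightarrow>
        prob_space (f obs xs) \<and> sets (f obs xs) = sets (restrict_space borel (edges obs)))"

definition anonymous :: "mechanism \<Rightarrow> bool" where
  "anonymous f \<longleftrightarrow>
     (\<forall>obs\<in>{0<..<1}. \<forall>xs ys. profile obs xs \<longrightarrow> mset xs = mset ys \<longrightarrow> f obs xs = f obs ys)"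

definition expected_cost :: "real \<Rightarrow> real \<Rightarrow> (real \<times> real) measure \<Rightarrow> real \<Rightarrow> real" where
  "expected_cost k obs P x = (\<integral>e. cost k obs e x \<partial>P)"

definition expected_max_cost :: "real \<Rightarrow> real \<Rightarrow> (real \<times> real) measure \<Rightarrow> real list \<Rightarrow> real" where
  "expected_max_cost k obs P xs = (\<integral>e. max_cost k obs e xs \<partial>P)"

definition same_region :: "real \<Rightarrow> real \<Rightarrow> real \<Rightarrow> bool" where
  "same_region obs x y \<longleftrightarrow>
     (x \<in> {0..<obs} \<and> y \<in> {0..<obs}) \<or> (x \<in> {obs<..1} \<and> y \<in> {obs<..1})"

definition strategyproof :: "real \<Rightarrow> mechanism \<Rightarrow> bool" where
  "strategyproof k f \<longleftrightarrow>
     (\<forall>obs\<in>{0<..<1}. \<forall>xs. profile obs xs \<longrightarrow>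
        (\<forall>i<length xs. \<forall>y. same_region obs (xs ! i) y \<longrightarrow>
           expected_cost k obs (f obs xs) (xs ! i)
             \<le> expected_cost k obs (f obs (xs[i := y])) (xs ! i)))"

text \<open>Extended reals: the ratio is \<open>\<infinity>\<close> if no real \<open>\<alpha>\<close> satisfies the bound on all instances.\<close>

definition approximation_ratio :: "real \<Rightarrow> mechanism \<Rightarrow> ereal" where
  "approximation_ratio k f =
     Inf {ereal \<alpha> | \<alpha>. \<forall>obs\<in>{0<..<1}. \<forall>xs. profile obs xs \<longrightarrow>
            expected_max_cost k obs (f obs xs) xs \<le> \<alpha> * opt_max_cost k obs xs}"

end

theory Submission
  imports Defs
begin

text \<open>
  Two agents at 1/4 and 1/2, both left of the obstacle, already force the bound. By
  strategyproofness, the cost of an agent at \<open>x\<close> cannot drop when it misreports so that \<open>x\<close>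
  becomes the midpoint of the reported profile; there the maximum cost is the cost at \<open>x\<close> plus
  half the distance of the reports, and the optimum is explicit. Moving the left agent to 0 and
  the right agent to 3/4 bounds the expected left endpoint of the edge from above and from below.
  The two bounds are compatible only if \<open>(3 + 5 k) / (2 + 5 k + k\<^sup>2) \<le> \<alpha>\<close>, and
  \<open>(3 + 5 k) (5 + 7 k) - (6 + 6 k) (2 + 5 k + k\<^sup>2) = (1 - k) (3 + 7 k + 6 k\<^sup>2) > 0\<close>.
\<close>

lemma cost_left: "x < obs \<Longrightarrow> cost k obs (a, b) x = \<bar>x - a\<bar> + k * (b - a) + (1 - b)"
  by (simp add: cost_def)

lemma max_cost_two: "max_cost k obs e [x, y] = max (cost k obs e x) (cost k obs e y)"
  by (simp add: max_cost_def)

text \<open>Both agents lie left of the obstacle, so their costs differ only in the distance to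
  \<open>a\<close>. Whichever side of \<open>x\<close> the endpoint \<open>a\<close> is on, the
  farther agent is at distance |x - a| + d from it.\<close>

lemma max_cost_symmetric_pair:
  assumes "0 \<le> d" "x + d < obs"
  shows "max_cost k obs e [x - d, x + d] = cost k obs e x + d"
proof (cases e)
  case (Pair a b)
  then show ?thesis
    using assms by (simp add: max_cost_two cost_left)
qed

lemma opt_max_cost_symmetric_pair_le:
  assumes k: "0 \<le> k" "k < 1" and obs: "0 < obs" "obs < 1"
    and d: "0 \<le> d" "d \<le> x" "x + d < obs"
  shows "opt_max_cost k obs [x - d, x + d] \<le> d + k * (1 - x)"
proof -
  have "profile obs [x - d, x + d]"
    using d by (auto simp: profile_def)
  then obtain e where e: "max_cost k obs e [x - d, x + d] = opt_max_cost k obs [x - d, x + d]"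
    "\<And>e'. e' \<in> edges obs \<Longrightarrow> max_cost k obs e [x - d, x + d] \<le> max_cost k obs e' [x - d, x + d]"
    using opt_max_cost_attained[OF k obs] by blast
  \<comment> \<open>The edge through the midpoint equalises the two distances at \<open>d\<close>,
    and \<open>b = 1\<close> removes the term \<open>1 - b\<close>.\<close>
  have "(x, 1) \<in> edges obs"
    using d obs by (simp add: edges_def)
  from e(2)[OF this] show ?thesis
    using e(1) d by (simp add: max_cost_symmetric_pair cost_left)
qed

text \<open>The set of edges is not compact, but it lies in the closed unit square, on which a
  continuous function is bounded.\<close>

lemma integrable_on_edges:
  fixes g :: "real \<times> real \<Rightarrow> real"
  assumes P: "prob_space P" "sets P = sets (restrict_space borel (edges obs))"
    and g: "continuous_on UNIV g" and obs: "0 < obs" "obs < 1"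
  shows "integrable P g"
proof -
  interpret prob_space P by (rule P)
  have space: "space P = edges obs"
    using sets_eq_imp_space_eq[OF P(2)] by (simp add: space_restrict_space)
  have "compact (g ` ({0..1} \<times> {0..1}))"
    by (intro compact_continuous_image compact_Times continuous_on_subset[OF g]) auto
  then obtain B where "\<And>e. e \<in> {0..1} \<times> {0..1} \<Longrightarrow> norm (g e) \<le> B"
    by (force dest!: compact_imp_bounded simp: bounded_iff)
  then have B: "norm (g e) \<le> B" if "e \<in> edges obs" for e
    using that obs by (force simp: edges_def)
  have "g \<in> borel_measurable (restrict_space borel (edges obs))"
    by (intro measurable_restrict_space1 borel_measurable_continuous_onI g)
  then have "g \<in> borel_measurable P"
    using measurable_cong_sets[OF P(2) refl] by blast
  moreover have "AE e in P. norm (g e) \<le> B"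
    using B space by auto
  ultimately show ?thesis
    by (rule integrable_const_bound[rotated])
qed

lemma continuous_on_cost: "x < obs \<Longrightarrow> continuous_on UNIV (\<lambda>e. cost k obs e x)"
  by (auto simp: cost_def case_prod_unfold intro!: continuous_intros)

lemma expected_max_cost_symmetric_pair:
  assumes P: "prob_space P" "sets P = sets (restrict_space borel (edges obs))"
    and obs: "0 < obs" "obs < 1" and d: "0 \<le> d" "x + d < obs"
  shows "expected_max_cost k obs P [x - d, x + d] = expected_cost k obs P x + d"
proof -
  interpret prob_space P by (rule P)
  have "integrable P (\<lambda>e. cost k obs e x)"
    using d by (intro integrable_on_edges[OF P _ obs] continuous_on_cost) auto
  then show ?thesis
    by (simp add: expected_max_cost_def expected_cost_def max_cost_symmetric_pair[OF d] prob_space)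
qed

text \<open>Makes the cost linear in \<open>a\<close> alone, so that only the mean left endpoint
  matters. The sign \<open>s\<close> picks a side of |x - a| \<ge> s (x - a); since k < 1, replacing
  \<open>b\<close> by 1 can only lower k (b - a) + (1 - b), to k (1 - a).\<close>

lemma expected_cost_left_ge:
  assumes P: "prob_space P" "sets P = sets (restrict_space borel (edges obs))"
    and obs: "0 < obs" "obs < 1" and x: "x < obs" and k: "k < 1" and s: "s = 1 \<or> s = -1"
  shows "s * (x - (\<integral>e. fst e \<partial>P)) + k * (1 - (\<integral>e. fst e \<partial>P)) \<le> expected_cost k obs P x"
proof -
  interpret prob_space P by (rule P)
  have space: "space P = edges obs"
    using sets_eq_imp_space_eq[OF P(2)] by (simp add: space_restrict_space)
  have int: "integrable P fst"
    by (intro integrable_on_edges[OF P _ obs] continuous_intros)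
  have "s * (x - (\<integral>e. fst e \<partial>P)) + k * (1 - (\<integral>e. fst e \<partial>P)) =
      (\<integral>e. s * (x - fst e) + k * (1 - fst e) \<partial>P)"
    using int by (simp add: prob_space)
  also have "\<dots> \<le> expected_cost k obs P x"
    unfolding expected_cost_def
  proof (rule integral_mono)
    show "integrable P (\<lambda>e. cost k obs e x)"
      using x by (intro integrable_on_edges[OF P _ obs] continuous_on_cost)
    show "integrable P (\<lambda>e. s * (x - fst e) + k * (1 - fst e))"
      by (intro integrable_on_edges[OF P _ obs] continuous_intros)
    fix e assume "e \<in> space P"
    then obtain a b where e: "e = (a, b)" "b \<le> 1"
      by (auto simp: space edges_def)
    have "k * (1 - b) \<le> 1 - b"
      using k e(2) mult_right_mono[of k 1 "1 - b"] by simp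
    moreover have "s * (x - a) \<le> \<bar>x - a\<bar>"
      using s by auto
    ultimately show "s * (x - fst e) + k * (1 - fst e) \<le> cost k obs e x"
      using x by (simp add: e cost_left algebra_simps)
  qed
  finally show ?thesis .
qed

lemma approximation_bound:
  assumes k: "0 \<le> k" "k < 1" and f: "randomized_mechanism f" "strategyproof k f"
    and approx: "\<And>obs xs. obs \<in> {0<..<1} \<Longrightarrow> profile obs xs \<Longrightarrow>
      expected_max_cost k obs (f obs xs) xs \<le> \<alpha> * opt_max_cost k obs xs"
    and \<alpha>: "0 \<le> \<alpha>"
  shows "3 + 5 * k \<le> \<alpha> * (2 + 5 * k + k\<^sup>2)"
proof -
  \<comment> \<open>The obstacle must lie beyond 3/4, the rightmost report used below.\<close>
  define obs :: real where "obs = 7/8"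
  have obs: "0 < obs" "obs < 1"
    by (auto simp: obs_def)
  have P: "prob_space (f obs xs)" "sets (f obs xs) = sets (restrict_space borel (edges obs))"
    if "profile obs xs" for xs
    using f(1) obs that by (auto simp: randomized_mechanism_def)
  \<comment> \<open>Here \<open>x\<close> is the true location of agent \<open>i\<close>, and the
    misreport \<open>y\<close> turns the profile into one centred at \<open>x\<close> with radius
    \<open>d\<close>.\<close>
  have bound: "expected_cost k obs (f obs [1/4, 1/2]) x + d \<le> \<alpha> * (d + k * (1 - x))"
    if i: "i < 2" "[1/4, 1/2] ! i = x" "[1/4, 1/2][i := y] = [x - d, x + d]"
      and d: "0 \<le> d" "d \<le> x" "x + d < obs" and y: "0 \<le> y" "y < obs" for i x y d
  proof -
    have prof: "profile obs [1/4, 1/2]" "profile obs [x - d, x + d]"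
      using d by (auto simp: profile_def obs_def)
    have "same_region obs x y"
      using d y by (auto simp: same_region_def)
    then have "expected_cost k obs (f obs [1/4, 1/2]) x
        \<le> expected_cost k obs (f obs ([1/4, 1/2][i := y])) x"
      using f(2) obs prof(1) i(1,2) unfolding strategyproof_def by fastforce
    then have "expected_cost k obs (f obs [1/4, 1/2]) x + d
        \<le> expected_max_cost k obs (f obs [x - d, x + d]) [x - d, x + d]"
      using expected_max_cost_symmetric_pair[OF P[OF prof(2)] obs d(1,3)] i(3) by simp
    also have "\<dots> \<le> \<alpha> * opt_max_cost k obs [x - d, x + d]"
      using obs prof(2) by (intro approx) auto
    also have "\<dots> \<le> \<alpha> * (d + k * (1 - x))"
      by (intro mult_left_mono opt_max_cost_symmetric_pair_le k obs d \<alpha>)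
    finally show ?thesis .
  qed
  define A where "A = (\<integral>e. fst e \<partial>f obs [1/4, 1/2])"
  have prof: "profile obs [1/4, 1/2]"
    by (auto simp: profile_def obs_def)
  \<comment> \<open>The agent at 1/4 reports 0, giving the profile 0, 1/2; the sign -1 yields an
    upper bound on \<open>A\<close>.\<close>
  have "(A - 1/4) + k * (1 - A) + 1/4 \<le> \<alpha> * (1/4 + k * (1 - 1/4))"
    using bound[of 0 "1/4" 0 "1/4"] expected_cost_left_ge[OF P[OF prof] obs _ k(2), of "1/4" "-1"]
    by (simp add: A_def obs_def)
  then have left: "(1 - k) * A + k \<le> \<alpha> * (1 + 3 * k) / 4"
    by (simp add: algebra_simps)
  \<comment> \<open>The agent at 1/2 reports 3/4, giving the profile 1/4, 3/4; the sign 1 yields a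
    lower bound on \<open>A\<close>.\<close>
  have "(1/2 - A) + k * (1 - A) + 1/4 \<le> \<alpha> * (1/4 + k * (1 - 1/2))"
    using bound[of 1 "1/2" "3/4" "1/4"] expected_cost_left_ge[OF P[OF prof] obs _ k(2), of "1/2" 1]
    by (simp add: A_def obs_def)
  then have right: "3/4 + k - (1 + k) * A \<le> \<alpha> * (1 + 2 * k) / 4"
    by (simp add: algebra_simps)
  \<comment> \<open>The nonnegative weights 1 + k and 1 - k are chosen so that \<open>A\<close>
    cancels.\<close>
  have "(1 + k) * ((1 - k) * A + k) + (1 - k) * (3/4 + k - (1 + k) * A)
      \<le> (1 + k) * (\<alpha> * (1 + 3 * k) / 4) + (1 - k) * (\<alpha> * (1 + 2 * k) / 4)"
    using k by (intro add_mono mult_left_mono left right) auto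
  then show ?thesis
    by (simp add: field_simps power2_eq_square)
qed

theorem theorem8:
  fixes k :: real
  assumes "0 \<le> k" and "k < 1"
  shows "\<not> (\<exists>f. randomized_mechanism f \<and> anonymous f \<and> strategyproof k f \<and>
               approximation_ratio k f < ereal ((6 + 6 * k) / (5 + 7 * k)))"
proof
  assume "\<exists>f. randomized_mechanism f \<and> anonymous f \<and> strategyproof k f \<and>
               approximation_ratio k f < ereal ((6 + 6 * k) / (5 + 7 * k))"
  then obtain f \<alpha> where f: "randomized_mechanism f" "strategyproof k f"
    and \<alpha>: "\<alpha> < (6 + 6 * k) / (5 + 7 * k)"
    and approx: "\<And>obs xs. obs \<in> {0<..<1} \<Longrightarrow> profile obs xs \<Longrightarrow>
      expected_max_cost k obs (f obs xs) xs \<le> \<alpha> * opt_max_cost k obs xs"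
    unfolding approximation_ratio_def Inf_less_iff by auto
  have opt_nonneg: "0 \<le> opt_max_cost k obs xs" if obs: "obs \<in> {0<..<1}" and xs: "profile obs xs" for obs xs
  proof -
    obtain e where e: "e \<in> edges obs" "opt_max_cost k obs xs = max_cost k obs e xs"
      using opt_max_cost_attained[of k obs xs] assms obs xs by auto
    have "0 \<le> cost k obs e x" for x
      using e(1) obs assms by (auto simp: cost_def edges_def)
    moreover obtain x where "x \<in> set xs"
      using xs by (cases xs) (auto simp: profile_def)
    ultimately show ?thesis
      unfolding e(2) max_cost_def
      by (meson Max_ge finite_imageI finite_set imageI order_trans)
  qed
  \<comment> \<open>The \<alpha> obtained from the infimum has no known sign. As optima are
    nonnegative, \<open>max 0 \<alpha>\<close> still satisfies the ratio bound, and it stays below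
    the claimed positive constant.\<close>
  have "3 + 5 * k \<le> max 0 \<alpha> * (2 + 5 * k + k\<^sup>2)"
  proof (rule approximation_bound[OF assms f])
    show "expected_max_cost k obs (f obs xs) xs \<le> max 0 \<alpha> * opt_max_cost k obs xs"
      if "obs \<in> {0<..<1}" "profile obs xs" for obs xs
      using approx[OF that] mult_right_mono[OF max.cobounded2[of \<alpha> 0] opt_nonneg[OF that]]
      by linarith
  qed simp
  also have "\<dots> \<le> (6 + 6 * k) / (5 + 7 * k) * (2 + 5 * k + k\<^sup>2)"
    using assms \<alpha> by (intro mult_right_mono) auto
  finally have "(3 + 5 * k) * (5 + 7 * k) \<le> (6 + 6 * k) * (2 + 5 * k + k\<^sup>2)"
    using assms by (simp add: field_simps)
  moreover have "(3 + 5 * k) * (5 + 7 * k) - (6 + 6 * k) * (2 + 5 * k + k\<^sup>2)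
      = (1 - k) * (3 + 7 * k + 6 * k\<^sup>2)"
    by (simp add: algebra_simps power2_eq_square)
  \<comment> \<open>Strictness comes from k < 1; the gap closes at k = 1.\<close>
  moreover have "0 < (1 - k) * (3 + 7 * k + 6 * k\<^sup>2)"
    using assms by (intro mult_pos_pos add_pos_nonneg) auto
  ultimately show False
    by linarith
qed

end
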